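(* Let $r\ge 1$ be an integer and let $f(t)=\sum_{n=0}^{\infty} d_n\frac{t^n}{n!}\in\mathbb{C}[[t]]$ be a formal power series with $d_0=1$. Let the numbers $a_n^{(r)}\in\mathbb{C}$ $(n\ge 0)$ be defined by $$\frac{1}{(f(t))^r}=\sum_{n=0}^{\infty}a_n^{(r)}\frac{t^n}{n!}.$$ For every integer $e\ge 1$ put $$D_r(e)=\sum_{\substack{i_1+\cdots+i_r=e\\ i_1,\dots,i_r\ge 0}}\frac{d_{i_1}\cdots d_{i_r}}{i_1!\cdots i_r!}.$$ Then for every integer $n\ge 1$, $$a_n^{(r)}=n!\sum_{k=1}^{n}(-1)^k\sum_{\substack{e_1+\cdots+e_k=n\\ e_1,\dots,e_k\ge 1}}D_r(e_1)\cdots D_r(e_k).$$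
   Context: The numbers $a_n^{(r)}$ are called the related numbers of higher order Appell polynomials: the higher order Appell polynomials $A_n^{(r)}(z)$ are defined by $\frac{e^{zt}}{(f(t))^r}=\sum_{n=0}^{\infty}A_n^{(r)}(z)\frac{t^n}{n!}$, and $a_n^{(r)}=A_n^{(r)}(0)$. In the sums, $i_1,\dots,i_r$ and $e_1,\dots,e_k$ range over ordered tuples of integers. *)

theory Defs
  imports Complex_Main "HOL-Computational_Algebra.Formal_Power_Series"
begin

text \<open>Ordered tuples of integers are rendered as lists of natural numbers. Both index sets
  below are finite, so the sums over them are genuine finite sums.\<close>

definition weak_compositions :: "nat \<Rightarrow> nat \<Rightarrow> nat list set" where
  "weak_compositions m e = {xs. length xs = m \<and> sum_list xs = e}"

definition compositions :: "nat \<Rightarrow> nat \<Rightarrow> nat list set" where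
  "compositions k n = {xs. length xs = k \<and> (\<forall>x\<in>set xs. x \<ge> 1) \<and> sum_list xs = n}"

lemma finite_weak_compositions: "finite (weak_compositions m e)"
proof (rule finite_subset)
  show "weak_compositions m e \<subseteq> {xs. set xs \<subseteq> {..e} \<and> length xs = m}"
    by (auto simp: weak_compositions_def intro: member_le_sum_list)
  show "finite {xs. set xs \<subseteq> {..e} \<and> length xs = m}"
    by (rule finite_lists_length_eq) simp
qed

lemma finite_compositions: "finite (compositions k n)"
  by (rule finite_subset[OF _ finite_weak_compositions[of k n]])
    (auto simp: compositions_def weak_compositions_def)

definition D :: "(nat \<Rightarrow> complex) \<Rightarrow> nat \<Rightarrow> nat \<Rightarrow> complex" where
  "D d r e = (\<Sum>is\<in>weak_compositions r e.
     prod_list (map d is) / prod_list (map fact is))"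

end

theory Submission
  imports Defs
begin

text \<open>
  Write \<open>f ^ r = 1 + g\<close>. The multinomial Cauchy product identifies the coefficients of
  \<open>f ^ r\<close> with the numbers \<open>D d r e\<close>, so \<open>g\<close> has zero constant term (because \<open>d 0 = 1\<close>) and
  coefficients \<open>D d r e\<close> at all \<open>e \<ge> 1\<close>. Hence the geometric series
  \<open>1 / (1 + g) = 1 - g + g\<^sup>2 - \<dots>\<close> is valid, and since \<open>g ^ k\<close> starts in degree at least \<open>k\<close>,
  only the powers \<open>k \<le> n\<close> reach the coefficient of index \<open>n\<close>. Expanding each \<open>g ^ k\<close> by the
  Cauchy product once more, the vanishing constant term kills every index tuple with a zero entry,
  which leaves the sum over the compositions of \<open>n\<close> into \<open>k\<close> positive parts. For \<open>n \<ge> 1\<close> the term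
  \<open>k = 0\<close> vanishes too.
\<close>

unbundle fps_syntax

lemma prod_list_map_eq_prod_nth:
  "prod_list (map h xs) = (\<Prod>j<length xs. h (xs ! j))"
  for h :: "'b \<Rightarrow> 'a::comm_monoid_mult"
  by (induction xs) (simp_all add: prod.lessThan_Suc_shift del: prod.lessThan_Suc)

lemma weak_compositions_eq_natpermute: "weak_compositions m e = natpermute e m"
  by (auto simp: weak_compositions_def natpermute_def)

lemma fps_power_nth_weak_compositions:
  fixes g :: "'a::comm_ring_1 fps"
  shows "(g ^ m) $ e = (\<Sum>xs\<in>weak_compositions m e. prod_list (map (fps_nth g) xs))"
proof (cases m)
  case 0
  have "weak_compositions 0 e = (if e = 0 then {[]} else {})"
    by (auto simp: weak_compositions_def)
  then show ?thesis using 0 by simp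
next
  case (Suc k)
  have "prod_list (map (fps_nth g) xs) = (\<Prod>j=0..k. g $ (xs ! j))"
    if "xs \<in> weak_compositions m e" for xs
  proof -
    have "length xs = Suc k"
      using that Suc by (simp add: weak_compositions_def)
    then show ?thesis
      by (simp add: prod_list_map_eq_prod_nth lessThan_Suc_atMost atMost_atLeast0)
  qed
  then show ?thesis
    by (simp add: Suc fps_power_nth_Suc weak_compositions_eq_natpermute del: power_Suc)
qed

text \<open>In the Cauchy product, a tuple with a zero entry carries the factor \<open>g $ 0 = 0\<close>.\<close>

lemma fps_power_nth_compositions:
  fixes g :: "'a::idom fps"
  assumes "g $ 0 = 0"
  shows "(g ^ k) $ n = (\<Sum>es\<in>compositions k n. prod_list (map (fps_nth g) es))"
  unfolding fps_power_nth_weak_compositions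
proof (rule sum.mono_neutral_right)
  show "finite (weak_compositions k n)"
    by (rule finite_weak_compositions)
  show "compositions k n \<subseteq> weak_compositions k n"
    by (auto simp: compositions_def weak_compositions_def)
  show "\<forall>es\<in>weak_compositions k n - compositions k n. prod_list (map (fps_nth g) es) = 0"
  proof
    fix es assume "es \<in> weak_compositions k n - compositions k n"
    then have "0 \<in> set es"
      by (auto simp: compositions_def weak_compositions_def Suc_le_eq)
    then have "g $ 0 \<in> set (map (fps_nth g) es)"
      by auto
    then show "prod_list (map (fps_nth g) es) = 0"
      using assms by (simp add: prod_list_zero_iff)
  qed
qed

text \<open>The truncated geometric sum differs from the inverse of \<open>1 + g\<close> by a multiple of
  \<open>g ^ (n + 1)\<close>, which does not contribute in degree \<open>n\<close>.\<close>

lemma fps_inverse_one_plus_nth: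
  fixes g :: "'a::field fps"
  assumes "g $ 0 = 0"
  shows "inverse (1 + g) $ n = (\<Sum>k\<le>n. (-1) ^ k * (g ^ k) $ n)"
proof -
  have unit: "inverse (1 + g) * (1 + g) = 1"
    using assms by (intro inverse_mult_eq_1) simp
  have "1 - (- g) ^ Suc n = (1 + g) * (\<Sum>k\<le>n. (- g) ^ k)"
    using one_diff_power_eq[of "- g" "Suc n"] by (simp add: lessThan_Suc_atMost)
  then have "inverse (1 + g) * (1 - (- g) ^ Suc n)
      = (inverse (1 + g) * (1 + g)) * (\<Sum>k\<le>n. (- g) ^ k)"
    by (simp only: mult.assoc)
  then have "inverse (1 + g) = (\<Sum>k\<le>n. (- g) ^ k) + (- g) ^ Suc n * inverse (1 + g)"
    by (simp only: unit) (simp add: algebra_simps)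
  moreover have "((- g) ^ Suc n * inverse (1 + g)) $ n = 0"
  proof -
    have "((- g) ^ Suc n) $ i = 0" if "i < Suc n" for i
      using startsby_zero_power_prefix[of "- g" "Suc n"] assms that by simp
    then show ?thesis
      by (simp add: fps_mult_nth del: power_Suc)
  qed
  ultimately have "inverse (1 + g) $ n = (\<Sum>k\<le>n. (- g) ^ k) $ n"
    by (metis add.right_neutral fps_add_nth)
  also have "\<dots> = (\<Sum>k\<le>n. (-1) ^ k * (g ^ k) $ n)"
  proof -
    have "((- g) ^ k) $ n = (-1) ^ k * (g ^ k) $ n" for k
      by (cases "even k") simp_all
    then show ?thesis
      by (simp add: fps_sum_nth)
  qed
  finally show ?thesis .
qed

lemma prod_list_map_divide:
  fixes u v :: "'b \<Rightarrow> 'a::field"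
  shows "prod_list (map (\<lambda>i. u i / v i) xs) = prod_list (map u xs) / prod_list (map v xs)"
  by (induction xs) simp_all

text \<open>This is the link between the combinatorial sum \<open>D\<close> and the power series: \<open>D d r\<close> is the
  ordinary coefficient sequence of the \<open>r\<close>-th power of the exponential generating function
  of \<open>d\<close>.\<close>

lemma egf_power_nth_eq_D: "(Abs_fps (\<lambda>m. d m / fact m) ^ r) $ e = D d r e"
proof -
  have "fps_nth (Abs_fps (\<lambda>m. d m / fact m)) = (\<lambda>m. d m / fact m)"
    by auto
  then show ?thesis
    by (simp add: fps_power_nth_weak_compositions D_def prod_list_map_divide)
qed

theorem theorem1:
  fixes r n :: nat and d a :: "nat \<Rightarrow> complex" and f :: "complex fps"
  assumes "r \<ge> 1"
    and "f = Abs_fps (\<lambda>m. d m / fact m)"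
    and "d 0 = 1"
    and "1 / f ^ r = Abs_fps (\<lambda>m. a m / fact m)"
    and "n \<ge> 1"
  shows "a n = fact n * (\<Sum>k=1..n. (-1) ^ k *
           (\<Sum>es\<in>compositions k n. prod_list (map (D d r) es)))"
proof -
  define g where "g = f ^ r - 1"
  have const: "(f ^ r) $ 0 = 1"
    using assms(2,3) by (simp add: fps_power_zeroth)
  then have g0: "g $ 0 = 0"
    by (simp add: g_def)
  have g_nth: "g $ e = D d r e" if "e \<ge> 1" for e
    using that by (simp add: g_def assms(2) egf_power_nth_eq_D)
  have "1 / f ^ r = inverse (1 + g)"
    using const by (simp add: g_def fps_divide_unit)
  then have "a n / fact n = inverse (1 + g) $ n"
    by (metis assms(4) fps_nth_Abs_fps)
  also have "\<dots> = (\<Sum>k\<le>n. (-1) ^ k * (g ^ k) $ n)"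
    by (rule fps_inverse_one_plus_nth[OF g0])
  also have "\<dots> = (\<Sum>k=1..n. (-1) ^ k * (g ^ k) $ n)"
    using assms(5) by (intro sum.mono_neutral_right) (auto simp: not_le Suc_le_eq)
  also have "\<dots> = (\<Sum>k=1..n. (-1) ^ k * (\<Sum>es\<in>compositions k n. prod_list (map (D d r) es)))"
  proof -
    have "(g ^ k) $ n = (\<Sum>es\<in>compositions k n. prod_list (map (D d r) es))" for k
      unfolding fps_power_nth_compositions[OF g0]
      by (intro sum.cong arg_cong[where f = prod_list] map_cong)
        (auto simp: compositions_def intro: g_nth)
    then show ?thesis
      by simp
  qed
  finally show ?thesis
    by (simp add: field_simps)
qed

end
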